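(* Let $Q$ be a quadrilateral in $\mathbb{R}^2$ such that $Q$ is not a trapezoid, the diagonals of $Q$ are not parallel, and no three vertices of $Q$ lie on a line. Then there exists a conic section $H$ that satisfies the following properties: 1. If $c$ is a center of some conic that passes through the four vertices of $Q$, then $c$ lies on $H$. 2. Every point of $H$ is the unique center of some conic that passes through the four vertices of $Q$. 3. $H$ contains the midpoints of the four sides of $Q$, the midpoints of the two diagonals of $Q$, the two hidden vertices of $Q$, and the intersection of the two diagonals of $Q$. 4. The center of $H$ is the arithmetic mean of the four vertices of $Q$. 5. $H$ is a hyperbola if and only if $Q$ is strictly convex.
   Context: A quadrilateral $Q$ is given by four vertices $q^{(1)},q^{(2)},q^{(3)},q^{(4)}\in\mathbb{R}^2$ listed in order. Its sides are the segments $q^{(1)}q^{(2)}$, $q^{(2)}q^{(3)}$, $q^{(3)}q^{(4)}$, $q^{(4)}q^{(1)}$; its extended sides are the lines containing these segments; its diagonals are $q^{(1)}q^{(3)}$ and $q^{(2)}q^{(4)}$, and the intersection of the diagonals means the intersection of the lines containing them. A trapezoid is a quadrilateral with at least one pair of parallel opposite sides (so parallelograms are trapezoids). "Strictly convex" has its usual meaning: the sides bound a convex region and no three vertices lie on a line. Hidden vertices: if $Q$ is not a trapezoid and $L_1,L_2,L_3,L_4$ are its extended sides in order, the two hidden vertices of $Q$ are the intersection point of $L_1$ and $L_3$ and the intersection point of $L_2$ and $L_4$. A conic (conic section) is a nonempty set of the form $\{x\in\mathbb{R}^2: f(x)=0\}$ with $f:\mathbb{R}^2\to\mathbb{R}$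 a real polynomial of degree $2$; degenerate conics are allowed. "Hyperbola" means a non-degenerate hyperbola. A point $c\in\mathbb{R}^2$ is a center of a set $U\subseteq\mathbb{R}^2$ if and only if $x\in U$ implies $2c-x\in U$. A conic passes through a point if it contains it.
   Formalization: Property 5 is stated only for quadrilaterals whose opposite sides (as segments) do not meet; for crossed quadrilaterals it is false, since H is then a hyperbola although Q is not strictly convex, e.g. vertices (0,0), (2,3), (1,0), (0,1). *)

theory Defs
  imports "HOL-Analysis.Analysis"
begin

text \<open>
  A quadrilateral is given by its four vertices, listed in order, as four points of
  \<open>real^2\<close>. Repeated or collinear vertices are not excluded by the type.
\<close>

definition no_three_collinear :: "real^2 \<Rightarrow> real^2 \<Rightarrow> real^2 \<Rightarrow> real^2 \<Rightarrow> bool" where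
  "no_three_collinear q1 q2 q3 q4 \<longleftrightarrow>
     \<not> collinear {q1, q2, q3} \<and> \<not> collinear {q1, q2, q4} \<and>
     \<not> collinear {q1, q3, q4} \<and> \<not> collinear {q2, q3, q4}"

text \<open>The line through two distinct points.\<close>

abbreviation line :: "real^2 \<Rightarrow> real^2 \<Rightarrow> (real^2) set" where
  "line a b \<equiv> affine hull {a, b}"

text \<open>The library notion \<^const>\<open>affine_parallel\<close> counts a line as parallel to itself.\<close>

definition trapezoid :: "real^2 \<Rightarrow> real^2 \<Rightarrow> real^2 \<Rightarrow> real^2 \<Rightarrow> bool" where
  "trapezoid q1 q2 q3 q4 \<longleftrightarrow>
     affine_parallel (line q1 q2) (line q3 q4) \<or> affine_parallel (line q2 q3) (line q4 q1)"

text \<open>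
  Meaningful only if the two sets have exactly one common point, as two non-parallel lines
  in the plane do.
\<close>

definition intersection_point :: "(real^2) set \<Rightarrow> (real^2) set \<Rightarrow> real^2" where
  "intersection_point L M = (THE p. L \<inter> M = {p})"

definition hidden_vertices :: "real^2 \<Rightarrow> real^2 \<Rightarrow> real^2 \<Rightarrow> real^2 \<Rightarrow> (real^2) set" where
  "hidden_vertices q1 q2 q3 q4 =
     {intersection_point (line q1 q2) (line q3 q4), intersection_point (line q2 q3) (line q4 q1)}"

definition boundary :: "real^2 \<Rightarrow> real^2 \<Rightarrow> real^2 \<Rightarrow> real^2 \<Rightarrow> (real^2) set" where
  "boundary q1 q2 q3 q4 =
     closed_segment q1 q2 \<union> closed_segment q2 q3 \<union> closed_segment q3 q4 \<union> closed_segment q4 q1"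

definition strictly_convex :: "real^2 \<Rightarrow> real^2 \<Rightarrow> real^2 \<Rightarrow> real^2 \<Rightarrow> bool" where
  "strictly_convex q1 q2 q3 q4 \<longleftrightarrow>
     (\<exists>R. open R \<and> bounded R \<and> convex R \<and> frontier R = boundary q1 q2 q3 q4) \<and>
     no_three_collinear q1 q2 q3 q4"

text \<open>
  A quadrilateral is crossed if two opposite sides (as segments, not as lines) meet. A crossed
  quadrilateral is never strictly convex, even if its vertices, taken in another order, are
  those of a strictly convex quadrilateral.
\<close>

definition crossed :: "real^2 \<Rightarrow> real^2 \<Rightarrow> real^2 \<Rightarrow> real^2 \<Rightarrow> bool" where
  "crossed q1 q2 q3 q4 \<longleftrightarrow>
     closed_segment q1 q2 \<inter> closed_segment q3 q4 \<noteq> {} \<or>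
     closed_segment q2 q3 \<inter> closed_segment q4 q1 \<noteq> {}"

text \<open>Nonempty zero sets of real polynomials in two variables of degree exactly 2.\<close>

definition conic_section :: "(real^2) set \<Rightarrow> bool" where
  "conic_section C \<longleftrightarrow> C \<noteq> {} \<and>
     (\<exists>a b c d e f :: real. (a, b, c) \<noteq> (0, 0, 0) \<and>
        C = {x. a * (x $ 1)\<^sup>2 + b * (x $ 1) * (x $ 2) + c * (x $ 2)\<^sup>2
                  + d * (x $ 1) + e * (x $ 2) + f = 0})"

text \<open>
  Non-degenerate hyperbolas: the curves with equation $s^2/a^2 - t^2/b^2 = 1$ in a Cartesian
  coordinate system with origin \<open>p\<close> and orthonormal axis directions \<open>u\<close>, \<open>v\<close>.
\<close>

definition hyperbola :: "(real^2) set \<Rightarrow> bool" where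
  "hyperbola H \<longleftrightarrow>
     (\<exists>(p :: real^2) u v (a :: real) b. norm u = 1 \<and> norm v = 1 \<and> u \<bullet> v = 0 \<and> 0 < a \<and> 0 < b \<and>
        H = {x. ((x - p) \<bullet> u)\<^sup>2 / a\<^sup>2 - ((x - p) \<bullet> v)\<^sup>2 / b\<^sup>2 = 1})"

definition is_center :: "real^2 \<Rightarrow> (real^2) set \<Rightarrow> bool" where
  "is_center c U \<longleftrightarrow> (\<forall>x\<in>U. 2 *\<^sub>R c - x \<in> U)"

definition is_unique_center :: "real^2 \<Rightarrow> (real^2) set \<Rightarrow> bool" where
  "is_unique_center c U \<longleftrightarrow> is_center c U \<and> (\<forall>c'. is_center c' U \<longrightarrow> c' = c)"

end

theory Submission
  imports Defs
begin

text \<open>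
  Take the intersection of the diagonals as origin and the diagonals as axes, so that the vertices are
  \<open>(p, 0)\<close>, \<open>(0, s)\<close>, \<open>(r, 0)\<close>, \<open>(0, t)\<close>. The conics through them are
  \<open>l (st x\<^sup>2 + pr y\<^sup>2 - st(p+r) x - pr(s+t) y + prst) + k xy = 0\<close>, and \<open>m\<close> is a center of such a conic
  exactly if the gradient vanishes at \<open>m\<close>. These are two linear equations in \<open>(l, k)\<close>, and they have a
  nontrivial solution if and only if \<open>m\<close> lies on \<open>st x (2x - (p+r)) = pr y (2y - (s+t))\<close>, which is \<open>H\<close>.
  Completing squares, the right-hand side of the equation of \<open>H\<close> is proportional to
  \<open>(ps - rt)(pt - rs)\<close>, nonzero because the quadrilateral is not a trapezoid. So \<open>H\<close> is a hyperbola
  if \<open>prst > 0\<close>, and bounded if \<open>prst < 0\<close>; in the latter case one vertex lies inside the triangle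
  of the other three. If \<open>prst > 0\<close>, either both diagonals contain the origin and the quadrilateral is
  strictly convex, or neither does and it is crossed.
\<close>

section \<open>Lines in the plane\<close>

text \<open>The determinant with columns \<open>a\<close> and \<open>b\<close>. Stating parallelism
  and collinearity through its vanishing turns them into polynomial conditions on
  coordinates.\<close>

definition cross2 :: "real^2 \<Rightarrow> real^2 \<Rightarrow> real" where
  "cross2 a b = a $ 1 * b $ 2 - a $ 2 * b $ 1"

lemma cross2_eq_0_imp_scaleR:
  assumes "cross2 a b = 0" "a \<noteq> 0"
  obtains k where "b = k *\<^sub>R a"
proof (cases "a $ 1 = 0")
  case True
  then have a2: "a $ 2 \<noteq> 0"
    using assms(2) by (auto simp: vec_eq_iff forall_2)
  have "b = (b $ 2 / a $ 2) *\<^sub>R a"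
    using assms(1) True a2 by (auto simp: vec_eq_iff forall_2 cross2_def field_simps)
  then show ?thesis using that by blast
next
  case False
  have "b = (b $ 1 / a $ 1) *\<^sub>R a"
    using assms(1) False by (auto simp: vec_eq_iff forall_2 cross2_def field_simps)
  then show ?thesis using that by blast
qed

lemma collinear_iff_cross2:
  "collinear {a, b, c} \<longleftrightarrow> cross2 (b - a) (c - a) = 0" for a b c :: "real^2"
proof -
  have "collinear {a, b, c} \<longleftrightarrow> collinear {b, a, c}"
    by (metis insert_commute)
  also have "\<dots> \<longleftrightarrow> collinear {0, b - a, c - a}"
    by (rule collinear_3) (simp add: NO_MATCH_def)
  also have "\<dots> \<longleftrightarrow> b - a = 0 \<or> c - a = 0 \<or> (\<exists>k. c - a = k *\<^sub>R (b - a))"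
    by (rule collinear_lemma)
  also have "\<dots> \<longleftrightarrow> cross2 (b - a) (c - a) = 0"
  proof
    assume "b - a = 0 \<or> c - a = 0 \<or> (\<exists>k. c - a = k *\<^sub>R (b - a))"
    then show "cross2 (b - a) (c - a) = 0"
      by (elim disjE exE) (simp_all only: cross2_def, auto)
  next
    assume "cross2 (b - a) (c - a) = 0"
    then show "b - a = 0 \<or> c - a = 0 \<or> (\<exists>k. c - a = k *\<^sub>R (b - a))"
      using cross2_eq_0_imp_scaleR by blast
  qed
  finally show ?thesis .
qed

text \<open>The direction vectors are proportional with a nonzero factor, so translation by
  \<open>c - a\<close> carries one line onto the other. In contrapositive form this extracts nonzero
  determinants from the hypotheses on parallelism.\<close>

lemma cross2_eq_0_imp_affine_parallel:
  assumes "cross2 (b - a) (d - c) = 0" "a \<noteq> b" "c \<noteq> d"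
  shows "affine_parallel (line a b) (line c d)"
proof -
  obtain k where k: "d - c = k *\<^sub>R (b - a)"
    using cross2_eq_0_imp_scaleR assms(1,2) by (metis right_minus_eq)
  with assms(3) have "k \<noteq> 0" by auto
  have "x \<in> range (\<lambda>t. c + t *\<^sub>R (d - c)) \<longleftrightarrow> x \<in> (+) (c - a) ` range (\<lambda>t. a + t *\<^sub>R (b - a))" for x
  proof
    assume "x \<in> range (\<lambda>t. c + t *\<^sub>R (d - c))"
    then obtain t where "x = c + t *\<^sub>R (d - c)" by blast
    then have "x = (c - a) + (a + (t * k) *\<^sub>R (b - a))" by (simp add: k)
    then show "x \<in> (+) (c - a) ` range (\<lambda>t. a + t *\<^sub>R (b - a))" by blast
  next
    assume "x \<in> (+) (c - a) ` range (\<lambda>t. a + t *\<^sub>R (b - a))"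
    then obtain t where "x = (c - a) + (a + t *\<^sub>R (b - a))" by blast
    then have "x = c + (t / k) *\<^sub>R (d - c)" using \<open>k \<noteq> 0\<close> by (simp add: k)
    then show "x \<in> range (\<lambda>t. c + t *\<^sub>R (d - c))" by blast
  qed
  then show ?thesis
    unfolding affine_parallel_def affine_hull_2_alt by blast
qed

text \<open>Cramer's rule: \<open>?i\<close> and \<open>?j\<close> are the only parameters for which
  the points on the two lines agree.\<close>

lemma lines_Int_eq_singleton:
  assumes "cross2 (b - a) (d - c) \<noteq> 0"
  obtains z where "line a b \<inter> line c d = {z}"
proof -
  let ?D = "cross2 (b - a) (d - c)"
  let ?i = "cross2 (c - a) (d - c) / ?D" and ?j = "cross2 (c - a) (b - a) / ?D"
  have eq: "a + i *\<^sub>R (b - a) = c + j *\<^sub>R (d - c) \<longleftrightarrow> i = ?i \<and> j = ?j" for i j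
  proof
    assume e: "a + i *\<^sub>R (b - a) = c + j *\<^sub>R (d - c)"
    then have "i * (b$1 - a$1) = c$1 - a$1 + j * (d$1 - c$1)" "i * (b$2 - a$2) = c$2 - a$2 + j * (d$2 - c$2)"
      by (auto simp: vec_eq_iff forall_2 algebra_simps)
    then have "i * ?D = cross2 (c - a) (d - c)" "j * ?D = cross2 (c - a) (b - a)"
      unfolding cross2_def by (simp; algebra)+
    then show "i = ?i \<and> j = ?j" using assms by (auto simp: eq_divide_eq)
  next
    assume "i = ?i \<and> j = ?j"
    then have "i * ?D = cross2 (c - a) (d - c)" "j * ?D = cross2 (c - a) (b - a)"
      using assms by auto
    then have "?D * (a$1 + i * (b$1 - a$1)) = ?D * (c$1 + j * (d$1 - c$1))"
      "?D * (a$2 + i * (b$2 - a$2)) = ?D * (c$2 + j * (d$2 - c$2))"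
      unfolding cross2_def vector_minus_component by algebra+
    then show "a + i *\<^sub>R (b - a) = c + j *\<^sub>R (d - c)"
      using assms by (simp add: vec_eq_iff forall_2)
  qed
  have "line a b \<inter> line c d = {a + ?i *\<^sub>R (b - a)}"
    unfolding affine_hull_2_alt using eq by (auto simp: image_iff)
  then show ?thesis using that by blast
qed

lemma intersection_point_eqI:
  assumes "cross2 (b - a) (d - c) \<noteq> 0" "z \<in> line a b" "z \<in> line c d"
  shows "intersection_point (line a b) (line c d) = z"
proof -
  obtain y where "line a b \<inter> line c d = {y}"
    using lines_Int_eq_singleton[OF assms(1)] .
  with assms(2,3) show ?thesis
    unfolding intersection_point_def by auto
qed

lemma intersection_point_in_lines:
  assumes "cross2 (b - a) (d - c) \<noteq> 0"
  shows "intersection_point (line a b) (line c d) \<in> line a b \<inter> line c d"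
proof -
  obtain y where "line a b \<inter> line c d = {y}"
    using lines_Int_eq_singleton[OF assms] .
  then show ?thesis
    unfolding intersection_point_def by auto
qed

section \<open>Conics in an affine frame\<close>

text \<open>The arguments are two reals and not a point, so that the same polynomial can be
  evaluated at Cartesian coordinates or at the coordinates of an oblique frame.\<close>

definition quadr :: "real \<Rightarrow> real \<Rightarrow> real \<Rightarrow> real \<Rightarrow> real \<Rightarrow> real \<Rightarrow> real \<Rightarrow> real \<Rightarrow> real" where
  "quadr a b c d e f x y = a * x\<^sup>2 + b * x * y + c * y\<^sup>2 + d * x + e * y + f"

lemma quadr_substitution:
  assumes "(a, b, c) \<noteq> (0, 0, 0)" "\<alpha> * \<delta> - \<beta> * \<gamma> \<noteq> 0"
  obtains a' b' c' d' e' f' where "(a', b', c') \<noteq> (0, 0, 0)"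
    "\<And>x y. quadr a b c d e f (\<alpha> * x + \<beta> * y + k) (\<gamma> * x + \<delta> * y + l) = quadr a' b' c' d' e' f' x y"
proof -
  define a' b' c' where "a' = a * \<alpha>\<^sup>2 + b * \<alpha> * \<gamma> + c * \<gamma>\<^sup>2"
    and "b' = 2 * a * \<alpha> * \<beta> + b * (\<alpha> * \<delta> + \<beta> * \<gamma>) + 2 * c * \<gamma> * \<delta>"
    and "c' = a * \<beta>\<^sup>2 + b * \<beta> * \<delta> + c * \<delta>\<^sup>2"
  note defs = a'_def b'_def c'_def
  have "(a', b', c') \<noteq> (0, 0, 0)"
  proof
    let ?D = "\<alpha> * \<delta> - \<beta> * \<gamma>"
    assume "(a', b', c') = (0, 0, 0)"
    then have 0: "a' = 0" "b' = 0" "c' = 0" by auto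
    \<comment> \<open>The inverse substitution, scaled by \<open>?D\<close> to avoid fractions,
      recovers the quadratic part. Hence an invertible substitution cannot lower the degree.\<close>
    have "?D\<^sup>2 * a = a' * \<delta>\<^sup>2 - b' * \<gamma> * \<delta> + c' * \<gamma>\<^sup>2"
      "?D\<^sup>2 * c = a' * \<beta>\<^sup>2 - b' * \<alpha> * \<beta> + c' * \<alpha>\<^sup>2"
      "?D\<^sup>2 * b = - 2 * a' * \<beta> * \<delta> + b' * (\<alpha> * \<delta> + \<beta> * \<gamma>) - 2 * c' * \<alpha> * \<gamma>"
      unfolding defs by (simp_all add: algebra_simps power2_eq_square)
    then show False using 0 assms by auto
  qed
  moreover have "quadr a b c d e f (\<alpha> * x + \<beta> * y + k) (\<gamma> * x + \<delta> * y + l)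
      = quadr a' b' c' (2 * a * \<alpha> * k + b * (\<alpha> * l + \<gamma> * k) + 2 * c * \<gamma> * l + d * \<alpha> + e * \<gamma>)
          (2 * a * \<beta> * k + b * (\<beta> * l + \<delta> * k) + 2 * c * \<delta> * l + d * \<beta> + e * \<delta>)
          (quadr a b c d e f k l) x y" for x y
    unfolding quadr_def defs by (simp add: algebra_simps power2_eq_square)
  ultimately show ?thesis using that by blast
qed

lemma conic_section_quadr:
  "conic_section C \<longleftrightarrow> C \<noteq> {} \<and> (\<exists>a b c d e f. (a, b, c) \<noteq> (0, 0, 0) \<and>
     C = {z. quadr a b c d e f (z $ 1) (z $ 2) = 0})"
  unfolding conic_section_def quadr_def by (simp add: mult.assoc)

text \<open>Oblique coordinates with origin \<open>w\<close> and axis directions \<open>u\<close>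
  and \<open>v\<close>. The axes may meet at any nonzero angle, so that the two diagonals of a
  quadrilateral can serve as axes.\<close>

locale affine_frame =
  fixes w u v :: "real^2"
  assumes independent: "cross2 u v \<noteq> 0"
begin

definition pt :: "real \<Rightarrow> real \<Rightarrow> real^2" where
  "pt x y = w + x *\<^sub>R u + y *\<^sub>R v"

text \<open>Cramer's formulas for the solution of
  \<open>z - w = X z *\<^sub>R u + Y z *\<^sub>R v\<close>.\<close>

definition X :: "real^2 \<Rightarrow> real" where
  "X z = cross2 (z - w) v / cross2 u v"

definition Y :: "real^2 \<Rightarrow> real" where
  "Y z = cross2 u (z - w) / cross2 u v"

lemma X_pt [simp]: "X (pt x y) = x" and Y_pt [simp]: "Y (pt x y) = y"
  using independent unfolding X_def Y_def pt_def
  by (auto simp: cross2_def divide_eq_eq algebra_simps)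

lemma pt_X_Y [simp]: "pt (X z) (Y z) = z"
proof -
  have "cross2 u v * pt (X z) (Y z) $ k
      = cross2 u v * w $ k + cross2 (z - w) v * u $ k + cross2 u (z - w) * v $ k" for k
    using independent by (simp add: pt_def X_def Y_def algebra_simps)
  note 1 = this[of 1] and 2 = this[of 2]
  \<comment> \<open>The linear dependence of the three plane vectors \<open>u\<close>,
    \<open>v\<close> and \<open>z - w\<close>, with determinants as coefficients.\<close>
  have 3: "cross2 u v * w $ 1 + cross2 (z - w) v * u $ 1 + cross2 u (z - w) * v $ 1 = cross2 u v * z $ 1"
    "cross2 u v * w $ 2 + cross2 (z - w) v * u $ 2 + cross2 u (z - w) * v $ 2 = cross2 u v * z $ 2"
    unfolding cross2_def vector_minus_component by algebra+
  show ?thesis using 1 2 independent unfolding 3 by (simp add: vec_eq_iff forall_2)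
qed

lemma eq_pt_iff: "z = pt x y \<longleftrightarrow> X z = x \<and> Y z = y"
  by (metis pt_X_Y X_pt Y_pt)

lemma point_reflection_pt: "2 *\<^sub>R pt x y - pt x' y' = pt (2 * x - x') (2 * y - y')"
  by (simp add: pt_def vec_eq_iff algebra_simps)

lemma pt_affine_comb: "a + b = 1 \<Longrightarrow> a *\<^sub>R pt x y + b *\<^sub>R pt x' y' = pt (a * x + b * x') (a * y + b * y')"
proof -
  assume "a + b = 1"
  then have "b = 1 - a" by simp
  then show ?thesis by (simp only:) (simp add: pt_def vec_eq_iff algebra_simps)
qed

lemma midpoint_pt: "midpoint (pt x y) (pt x' y') = pt ((x + x') / 2) ((y + y') / 2)"
  using pt_affine_comb[of "1/2" "1/2"] by (simp add: midpoint_def scaleR_add_right add_divide_distrib)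

lemma cross2_pt_diff:
  "cross2 (pt x y - pt x' y') (pt a b - pt a' b') = ((x - x') * (b - b') - (y - y') * (a - a')) * cross2 u v"
  by (simp add: pt_def cross2_def algebra_simps)

lemma continuous_X: "continuous_on S X" and continuous_Y: "continuous_on S Y"
  unfolding X_def Y_def cross2_def by (intro continuous_intros; use independent in \<open>simp add: cross2_def\<close>)+

lemma X_affine: "X z = (v $ 2 / cross2 u v) * z $ 1 + (- v $ 1 / cross2 u v) * z $ 2 + X 0"
  and Y_affine: "Y z = (- u $ 2 / cross2 u v) * z $ 1 + (u $ 1 / cross2 u v) * z $ 2 + Y 0"
  using independent by (auto simp: X_def Y_def cross2_def divide_simps) (auto simp: algebra_simps)

text \<open>Being a conic is invariant under affine changes of coordinates:
  \<open>quadr_substitution\<close> applies to the change from Cartesian to frame coordinates and to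
  its inverse.\<close>

lemma conic_section_in_frame:
  "conic_section C \<longleftrightarrow> C \<noteq> {} \<and> (\<exists>a b c d e f. (a, b, c) \<noteq> (0, 0, 0) \<and>
     C = {z. quadr a b c d e f (X z) (Y z) = 0})"
proof -
  have to_frame: "\<exists>a b c d e f. (a, b, c) \<noteq> (0, 0, 0) \<and> C = {z. quadr a b c d e f (X z) (Y z) = 0}"
    if abc: "(a, b, c) \<noteq> (0, 0, 0)" and C: "C = {z. quadr a b c d e f (z $ 1) (z $ 2) = 0}"
    for a b c d e f
  proof -
    have "u $ 1 * v $ 2 - v $ 1 * u $ 2 \<noteq> 0" using independent by (simp add: cross2_def mult.commute)
    then obtain a' b' c' d' e' f' where abc': "(a', b', c') \<noteq> (0, 0, 0)"
      and q: "\<And>x y. quadr a b c d e f (u $ 1 * x + v $ 1 * y + w $ 1) (u $ 2 * x + v $ 2 * y + w $ 2)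
         = quadr a' b' c' d' e' f' x y"
      using quadr_substitution[OF abc, of "u $ 1" "v $ 2" "v $ 1" "u $ 2" d e f "w $ 1" "w $ 2"] by metis
    have "quadr a b c d e f (pt x y $ 1) (pt x y $ 2) = quadr a' b' c' d' e' f' x y" for x y
      using q[of x y] by (simp add: pt_def algebra_simps)
    from this[of "X z" "Y z" for z] have "C = {z. quadr a' b' c' d' e' f' (X z) (Y z) = 0}"
      unfolding C by simp
    with abc' show ?thesis by blast
  qed
  have from_frame: "\<exists>a b c d e f. (a, b, c) \<noteq> (0, 0, 0) \<and> C = {z. quadr a b c d e f (z $ 1) (z $ 2) = 0}"
    if abc: "(a, b, c) \<noteq> (0, 0, 0)" and C: "C = {z. quadr a b c d e f (X z) (Y z) = 0}"
    for a b c d e f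
  proof -
    let ?D = "cross2 u v"
    \<comment> \<open>The linear part of the map from \<open>z\<close> to \<open>(X z, Y z)\<close>
      has determinant \<open>1 / ?D\<close>, written here as \<open>?D / (?D * ?D)\<close>.\<close>
    have "(v $ 2 / ?D) * (u $ 1 / ?D) - (- v $ 1 / ?D) * (- u $ 2 / ?D) = (u $ 1 * v $ 2 - u $ 2 * v $ 1) / (?D * ?D)"
      by (simp add: diff_divide_distrib mult.commute)
    also have "\<dots> = ?D / (?D * ?D)" by (simp only: cross2_def)
    finally have "(v $ 2 / ?D) * (u $ 1 / ?D) - (- v $ 1 / ?D) * (- u $ 2 / ?D) = ?D / (?D * ?D)" .
    then have "(v $ 2 / ?D) * (u $ 1 / ?D) - (- v $ 1 / ?D) * (- u $ 2 / ?D) \<noteq> 0"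
      using independent by simp
    from quadr_substitution[OF abc this]
    obtain a' b' c' d' e' f' where abc': "(a', b', c') \<noteq> (0, 0, 0)"
      and q: "\<And>x y. quadr a b c d e f (v $ 2 / ?D * x + - v $ 1 / ?D * y + X 0)
        (- u $ 2 / ?D * x + u $ 1 / ?D * y + Y 0) = quadr a' b' c' d' e' f' x y"
      by blast
    have "quadr a b c d e f (X z) (Y z) = quadr a' b' c' d' e' f' (z $ 1) (z $ 2)" for z
      unfolding X_affine[of z] Y_affine[of z] by (rule q)
    then have "C = {z. quadr a' b' c' d' e' f' (z $ 1) (z $ 2) = 0}"
      unfolding C by simp
    with abc' show ?thesis by blast
  qed
  show ?thesis
    unfolding conic_section_quadr
    by (intro conj_cong refl iffI; elim exE conjE; rule to_frame from_frame; assumption)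
qed

text \<open>\<open>f z - f (2c - z)\<close> is an affine function of \<open>z\<close> that vanishes at \<open>c\<close>; its coefficients are
  twice the gradient of \<open>f\<close> at \<open>c\<close>.\<close>
lemma quadr_diff_reflection:
  "quadr a b c d e f x y - quadr a b c d e f (2 * x0 - x) (2 * y0 - y) =
     2 * ((2 * a * x0 + b * y0 + d) * (x - x0) + (b * x0 + 2 * c * y0 + e) * (y - y0))"
  unfolding quadr_def by (simp add: algebra_simps power2_eq_square)

lemma is_center_if_gradient_eq_0:
  assumes "2 * a * X m + b * Y m + d = 0" "b * X m + 2 * c * Y m + e = 0"
  shows "is_center m {z. quadr a b c d e f (X z) (Y z) = 0}"
proof -
  have "quadr a b c d e f (X (2 *\<^sub>R m - z)) (Y (2 *\<^sub>R m - z)) = quadr a b c d e f (X z) (Y z)" for z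
    using quadr_diff_reflection[of a b c d e f "X z" "Y z" "X m" "Y m"] assms
      point_reflection_pt[of "X m" "Y m" "X z" "Y z"] by simp
  then show ?thesis by (simp add: is_center_def)
qed

text \<open>A symmetric zero set does not by itself make the polynomial symmetric. But at a point of
  \<open>C\<close> the polynomial vanishes there and at the reflected point, so the affine function
  of \<open>quadr_diff_reflection\<close> is zero on \<open>C\<close>. Vanishing at three
  non-collinear points, it is identically zero.\<close>

lemma gradient_eq_0_if_is_center:
  assumes "is_center m C" and C: "C = {z. quadr a b c d e f (X z) (Y z) = 0}"
    and in_C: "{pt x1 y1, pt x2 y2, pt x3 y3} \<subseteq> C"
    and nondeg: "(x2 - x1) * (y3 - y1) - (y2 - y1) * (x3 - x1) \<noteq> 0"
  shows "2 * a * X m + b * Y m + d = 0" "b * X m + 2 * c * Y m + e = 0"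
proof -
  define D E where "D = 2 * a * X m + b * Y m + d" and "E = b * X m + 2 * c * Y m + e"
  have lin: "D * (x - X m) + E * (y - Y m) = 0" if "pt x y \<in> C" for x y
  proof -
    have "2 *\<^sub>R m - pt x y \<in> C" using assms(1) that by (auto simp: is_center_def)
    then have "pt (2 * X m - x) (2 * Y m - y) \<in> C"
      using point_reflection_pt[of "X m" "Y m" x y] by simp
    with that have "quadr a b c d e f x y = 0" "quadr a b c d e f (2 * X m - x) (2 * Y m - y) = 0"
      unfolding C by simp_all
    then show ?thesis
      using quadr_diff_reflection[of a b c d e f x y "X m" "Y m"] unfolding D_def E_def by simp
  qed
  have "D * (x1 - X m) + E * (y1 - Y m) = 0" "D * (x2 - X m) + E * (y2 - Y m) = 0"
    "D * (x3 - X m) + E * (y3 - Y m) = 0"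
    using in_C by (simp_all add: lin)
  then have "D * (x2 - x1) + E * (y2 - y1) = 0" "D * (x3 - x1) + E * (y3 - y1) = 0"
    by (simp_all add: right_diff_distrib)
  then have "D * ((x2 - x1) * (y3 - y1) - (y2 - y1) * (x3 - x1)) = 0"
    "E * ((x2 - x1) * (y3 - y1) - (y2 - y1) * (x3 - x1)) = 0"
    by algebra+
  then have "D = 0" "E = 0" using nondeg by simp_all
  then show "2 * a * X m + b * Y m + d = 0" "b * X m + 2 * c * Y m + e = 0"
    unfolding D_def E_def .
qed

end

section \<open>Recognizing hyperbolas\<close>

lemma inner_real2: "x \<bullet> y = x $ 1 * y $ 1 + x $ 2 * y $ 2" for x y :: "real^2"
  by (simp add: inner_vec_def sum_2)

lemma hyperbola_orthonormal:
  assumes "norm u = 1" "norm v = 1" "u \<bullet> v = 0" and AB: "A * B < 0" and "K \<noteq> 0"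
  shows "hyperbola {z. A * ((z - m) \<bullet> u)\<^sup>2 + B * ((z - m) \<bullet> v)\<^sup>2 = K}"
proof -
  \<comment> \<open>The sign of \<open>K / A\<close> decides which axis meets the hyperbola. This
    fact is general in \<open>u\<close>, \<open>v\<close>, \<open>A\<close> and \<open>B\<close>, so
    the other sign follows by swapping the two axes.\<close>
  have *: "hyperbola {z. A * ((z - m) \<bullet> u)\<^sup>2 + B * ((z - m) \<bullet> v)\<^sup>2 = K}"
    if uv: "norm u = 1" "norm v = 1" "u \<bullet> v = 0" and "A * B < 0" and KA: "K / A > 0"
    for u v :: "real^2" and A B
  proof -
    from that have KB: "- K / B > 0"
      by (auto simp: zero_less_divide_iff divide_less_0_iff mult_less_0_iff)
    have "s / (sqrt (K / A))\<^sup>2 - t / (sqrt (- K / B))\<^sup>2 = (A * s + B * t) / K" for s t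
      using KA KB by (simp add: add_divide_distrib mult.commute)
    then have "{z. A * ((z - m) \<bullet> u)\<^sup>2 + B * ((z - m) \<bullet> v)\<^sup>2 = K}
      = {z. ((z - m) \<bullet> u)\<^sup>2 / (sqrt (K / A))\<^sup>2 - ((z - m) \<bullet> v)\<^sup>2 / (sqrt (- K / B))\<^sup>2 = 1}"
      using \<open>K \<noteq> 0\<close> by (simp only:) (auto simp: divide_eq_1_iff)
    moreover have "0 < sqrt (K / A)" "0 < sqrt (- K / B)"
      using KA KB by simp_all
    ultimately show ?thesis
      unfolding hyperbola_def using uv by blast
  qed
  show ?thesis
  proof (cases "K / A > 0")
    case True
    then show ?thesis using * assms by blast
  next
    case False
    with AB \<open>K \<noteq> 0\<close> have "K / B > 0"
      by (auto simp: zero_less_divide_iff mult_less_0_iff)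
    from *[OF assms(2,1) _ _ this, of A] show ?thesis
      using assms by (simp add: inner_commute add.commute mult.commute)
  qed
qed

lemma hyperbola_quadratic:
  fixes m :: "real^2"
  assumes disc: "b\<^sup>2 - 4 * a * c > 0" and "k \<noteq> 0"
  shows "hyperbola {z. a * (z $ 1 - m $ 1)\<^sup>2 + b * (z $ 1 - m $ 1) * (z $ 2 - m $ 2)
     + c * (z $ 2 - m $ 2)\<^sup>2 = k}"
proof -
  \<comment> \<open>Principal axes: rotation by half the polar angle of \<open>(a - c, b)\<close>
    removes the mixed term. The eigenvalues of the quadratic form are then
    \<open>(a + c + R) / 2\<close> and \<open>(a + c - R) / 2\<close>, and four times their product
    is minus the discriminant.\<close>
  obtain R \<phi> where R: "a - c = R * cos \<phi>" "b = R * sin \<phi>"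
    using polar_Ex by blast
  define C S where "C = cos (\<phi> / 2)" and "S = sin (\<phi> / 2)"
  have CS: "C\<^sup>2 + S\<^sup>2 = 1" unfolding C_def S_def by simp
  have ac: "a - c = R * (C\<^sup>2 - S\<^sup>2)" and b: "b = 2 * R * S * C"
    using R cos_double[of "\<phi> / 2"] sin_double[of "\<phi> / 2"] unfolding C_def S_def by simp_all
  define A B where "A = (a + c + R) / 2" and "B = (a + c - R) / 2"
  have "4 * A * B = (a + c)\<^sup>2 - R\<^sup>2 * (C\<^sup>2 + S\<^sup>2)\<^sup>2"
    unfolding CS A_def B_def by (simp add: field_simps power2_eq_square)
  also have "R\<^sup>2 * (C\<^sup>2 + S\<^sup>2)\<^sup>2 = (a - c)\<^sup>2 + b\<^sup>2"
    unfolding ac b by algebra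
  finally have "A * B < 0" using disc by (simp add: power2_eq_square algebra_simps)
  have AB: "A + B = a + c" "A - B = R"
    unfolding A_def B_def by (simp_all add: field_simps)
  have a: "a = A * C\<^sup>2 + B * S\<^sup>2" and c: "c = A * S\<^sup>2 + B * C\<^sup>2" and b': "b = 2 * (A - B) * S * C"
    using CS ac b AB by algebra+
  define u v :: "real^2" where "u = vector [C, S]" and "v = vector [- S, C]"
  have uv: "norm u = 1" "norm v = 1" "u \<bullet> v = 0"
    using CS unfolding u_def v_def norm_eq_sqrt_inner inner_real2
    by (simp_all add: power2_eq_square add.commute)
  have "a * (z $ 1 - m $ 1)\<^sup>2 + b * (z $ 1 - m $ 1) * (z $ 2 - m $ 2) + c * (z $ 2 - m $ 2)\<^sup>2
     = A * ((z - m) \<bullet> u)\<^sup>2 + B * ((z - m) \<bullet> v)\<^sup>2" for z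
    unfolding a b' c u_def v_def inner_real2 vector_2 vector_minus_component
    by (simp add: power2_eq_square algebra_simps)
  then show ?thesis
    using hyperbola_orthonormal[OF uv \<open>A * B < 0\<close> \<open>k \<noteq> 0\<close>] by simp
qed

lemma not_bounded_hyperbola:
  assumes "hyperbola H"
  shows "\<not> bounded H"
proof
  assume "bounded H"
  then obtain M where M: "\<And>z. z \<in> H \<Longrightarrow> norm z \<le> M" by (auto simp: bounded_iff)
  obtain p u v a b where uv: "norm u = 1" "norm v = 1" "u \<bullet> v = 0" and ab: "0 < a" "0 < b"
    and H: "H = {x. ((x - p) \<bullet> u)\<^sup>2 / a\<^sup>2 - ((x - p) \<bullet> v)\<^sup>2 / b\<^sup>2 = 1}"
    using assms unfolding hyperbola_def by blast
  have uv': "u \<bullet> u = 1" "v \<bullet> v = 1" "v \<bullet> u = 0"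
    using uv by (simp_all add: norm_eq_1 inner_commute)
  \<comment> \<open>The point \<open>p + d\<close> lies on the hyperbola for every \<open>t\<close>.
    This \<open>t\<close> makes the component of \<open>d\<close> along \<open>v\<close> exceed
    \<open>M + norm p\<close>, the largest norm that \<open>d\<close> could have.\<close>
  define t where "t = (\<bar>M\<bar> + norm p + 1) / b"
  define d where "d = (a * sqrt (1 + t\<^sup>2)) *\<^sub>R u + (b * t) *\<^sub>R v"
  have du: "d \<bullet> u = a * sqrt (1 + t\<^sup>2)" and dv: "d \<bullet> v = b * t"
    unfolding d_def using uv' uv(3) by (simp_all add: inner_add_left)
  have "0 \<le> 1 + t\<^sup>2" by simp
  then have "p + d \<in> H"
    unfolding H using ab by (simp add: du dv power_mult_distrib)
  then have "norm (p + d) \<le> M" by (rule M)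
  moreover have "norm d \<le> norm (p + d) + norm p"
    using norm_triangle_ineq4[of "p + d" p] by simp
  moreover have "b * t \<le> norm d"
    using norm_cauchy_schwarz[of d v] dv uv by simp
  moreover have "b * t = \<bar>M\<bar> + norm p + 1"
    unfolding t_def using ab by simp
  ultimately show False by linarith
qed

section \<open>Hyperbolas and ellipses in oblique coordinates\<close>

context affine_frame
begin

lemma X_affine_comb: "a + b = 1 \<Longrightarrow> X (a *\<^sub>R z + b *\<^sub>R z') = a * X z + b * X z'"
  and Y_affine_comb: "a + b = 1 \<Longrightarrow> Y (a *\<^sub>R z + b *\<^sub>R z') = a * Y z + b * Y z'"
  using pt_affine_comb[of a b "X z" "Y z" "X z'" "Y z'"] by simp_all

lemma boundedI_in_frame:
  assumes "\<And>z. z \<in> S \<Longrightarrow> \<bar>X z\<bar> \<le> M" "\<And>z. z \<in> S \<Longrightarrow> \<bar>Y z\<bar> \<le> M"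
  shows "bounded S"
  unfolding bounded_iff
proof (intro exI ballI)
  fix z assume "z \<in> S"
  have "norm (pt (X z) (Y z)) \<le> norm w + norm (X z *\<^sub>R u) + norm (Y z *\<^sub>R v)"
    unfolding pt_def by (intro order.trans[OF norm_triangle_ineq] add_mono order.refl)
  also have "\<dots> \<le> norm w + M * norm u + M * norm v"
    using assms[OF \<open>z \<in> S\<close>] by (auto intro!: add_mono mult_right_mono)
  finally show "norm z \<le> norm w + M * norm u + M * norm v" by simp
qed

text \<open>As \<open>u\<close> and \<open>v\<close> need not be orthonormal, they need not give the
  principal axes. The equation is therefore rewritten in Cartesian coordinates; this multiplies the
  discriminant by a nonzero square and preserves its sign.\<close>

lemma hyperbola_in_frame:
  assumes "A * B < 0" "K \<noteq> 0"
  shows "hyperbola {z. A * (X z - x0)\<^sup>2 + B * (Y z - y0)\<^sup>2 = K}"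
proof -
  let ?D = "cross2 u v"
  define \<alpha> \<beta> \<gamma> \<delta> m where "\<alpha> = v $ 2 / ?D" "\<beta> = - v $ 1 / ?D" "\<gamma> = - u $ 2 / ?D" "\<delta> = u $ 1 / ?D"
    "m = pt x0 y0"
  note defs = this
  define a b c where "a = A * \<alpha>\<^sup>2 + B * \<gamma>\<^sup>2" "b = 2 * A * \<alpha> * \<beta> + 2 * B * \<gamma> * \<delta>" "c = A * \<beta>\<^sup>2 + B * \<delta>\<^sup>2"
  note abc = this
  have x: "X z - x0 = \<alpha> * (z $ 1 - m $ 1) + \<beta> * (z $ 2 - m $ 2)" for z
    using X_affine[of z] X_affine[of m] unfolding defs(1,2) by (simp add: defs(5) algebra_simps)
  have y: "Y z - y0 = \<gamma> * (z $ 1 - m $ 1) + \<delta> * (z $ 2 - m $ 2)" for z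
    using Y_affine[of z] Y_affine[of m] unfolding defs(3,4) by (simp add: defs(5) algebra_simps)
  have "\<alpha> * \<delta> - \<beta> * \<gamma> = (u $ 1 * v $ 2 - u $ 2 * v $ 1) / (?D * ?D)"
    unfolding defs by (simp add: diff_divide_distrib mult.commute)
  also have "\<dots> = ?D / (?D * ?D)" by (simp only: cross2_def)
  finally have nz: "(\<alpha> * \<delta> - \<beta> * \<gamma>)\<^sup>2 > 0" using independent by simp
  have "b\<^sup>2 - 4 * a * c = 4 * - (A * B) * (\<alpha> * \<delta> - \<beta> * \<gamma>)\<^sup>2"
    unfolding abc by (simp add: power2_eq_square algebra_simps)
  moreover have "4 * - (A * B) * (\<alpha> * \<delta> - \<beta> * \<gamma>)\<^sup>2 > 0"
    using assms(1) nz by (intro mult_pos_pos) auto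
  ultimately have "b\<^sup>2 - 4 * a * c > 0" by simp
  moreover have "A * (X z - x0)\<^sup>2 + B * (Y z - y0)\<^sup>2 = a * (z $ 1 - m $ 1)\<^sup>2
      + b * (z $ 1 - m $ 1) * (z $ 2 - m $ 2) + c * (z $ 2 - m $ 2)\<^sup>2" for z
    unfolding x y abc by (simp add: power2_eq_square algebra_simps)
  ultimately show ?thesis
    using hyperbola_quadratic[of b a c K m] assms(2) by simp
qed

lemma bounded_ellipse_in_frame:
  assumes "A * B > 0"
  shows "bounded {z. A * (X z - x0)\<^sup>2 + B * (Y z - y0)\<^sup>2 = K}"
proof -
  \<comment> \<open>After division by \<open>A\<close> both squares have nonnegative coefficients,
    so each is bounded. Stating this for arbitrary \<open>A\<close>, \<open>B\<close>,
    \<open>x\<close>, \<open>y\<close> lets it bound both coordinates.\<close>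
  have bd: "\<bar>x\<bar> \<le> 1 + \<bar>K / A\<bar> + \<bar>x0\<bar>" if "A * (x - x0)\<^sup>2 + B * (y - y0)\<^sup>2 = K" and AB: "A * B > 0"
    for A B x y x0 y0 :: real
  proof -
    have "A \<noteq> 0" using AB by auto
    have "(x - x0)\<^sup>2 + (A * B) * (y - y0)\<^sup>2 / A\<^sup>2 = (A * (x - x0)\<^sup>2 + B * (y - y0)\<^sup>2) / A"
      using \<open>A \<noteq> 0\<close> by (simp add: add_divide_distrib power2_eq_square)
    then have "(x - x0)\<^sup>2 + (A * B) * (y - y0)\<^sup>2 / A\<^sup>2 = K / A"
      unfolding that(1) .
    moreover have "(A * B) * (y - y0)\<^sup>2 / A\<^sup>2 \<ge> 0" using AB by simp
    ultimately have "\<bar>x - x0\<bar>\<^sup>2 \<le> \<bar>K / A\<bar>"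
      unfolding power2_abs by linarith
    moreover have "2 * \<bar>x - x0\<bar> \<le> 1 + \<bar>x - x0\<bar>\<^sup>2"
      using sum_squares_bound[of 1 "\<bar>x - x0\<bar>"] by simp
    ultimately have "\<bar>x - x0\<bar> \<le> 1 + \<bar>K / A\<bar>"
      using abs_ge_zero[of "x - x0"] by argo
    then show ?thesis by argo
  qed
  show ?thesis
  proof (rule boundedI_in_frame)
    let ?M = "1 + \<bar>K / A\<bar> + \<bar>K / B\<bar> + \<bar>x0\<bar> + \<bar>y0\<bar>"
    fix z assume "z \<in> {z. A * (X z - x0)\<^sup>2 + B * (Y z - y0)\<^sup>2 = K}"
    then have z: "A * (X z - x0)\<^sup>2 + B * (Y z - y0)\<^sup>2 = K" by simp
    then have z': "B * (Y z - y0)\<^sup>2 + A * (X z - x0)\<^sup>2 = K" by simp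
    show "\<bar>X z\<bar> \<le> ?M" using bd[OF z assms] by linarith
    show "\<bar>Y z\<bar> \<le> ?M" using bd[OF z'] assms unfolding mult.commute[of B A] by linarith
  qed
qed

end

section \<open>Convexity of a quadrilateral with vertices on the axes\<close>

text \<open>The closure of \<open>R\<close> is convex and contains the triangle. So the interior of
  the triangle lies in the interior of that closure, which is \<open>R\<close> itself, and an open
  set misses its frontier.\<close>

lemma triangle_interior_not_in_frontier:
  fixes a b c :: "real^2"
  assumes "\<not> collinear {a, b, c}" "open R" "convex R" "{a, b, c} \<subseteq> frontier R"
    and "0 < x" "0 < y" "0 < z" "x + y + z = 1"
  shows "x *\<^sub>R a + y *\<^sub>R b + z *\<^sub>R c \<notin> frontier R"
proof -
  have "{a, b, c} \<subseteq> closure R"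
    using assms(4) by (auto simp: frontier_def)
  then have "convex hull {a, b, c} \<subseteq> closure R"
    using assms(3) by (simp add: subset_hull convex_closure)
  then have "interior (convex hull {a, b, c}) \<subseteq> interior (closure R)"
    by (rule interior_mono)
  also have "\<dots> = R"
    using assms(2,3) by (simp add: convex_interior_closure interior_open)
  finally have "x *\<^sub>R a + y *\<^sub>R b + z *\<^sub>R c \<in> R"
    using assms(1,5-) by (subst (asm) interior_convex_hull_3_minimal) auto
  then show ?thesis
    using assms(2) by (simp add: frontier_def interior_open)
qed

context affine_frame
begin

text \<open>The intercept form of the line. Dividing by \<open>p\<close> and \<open>s\<close> makes
  it cover all four quadrants without a case distinction on signs.\<close>

lemma closed_segment_axes:
  assumes "p \<noteq> 0" "s \<noteq> 0"
  shows "closed_segment (pt p 0) (pt 0 s) = {z. 0 \<le> X z / p \<and> 0 \<le> Y z / s \<and> X z / p + Y z / s = 1}"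
proof (intro equalityI subsetI)
  fix z assume "z \<in> closed_segment (pt p 0) (pt 0 s)"
  then obtain i where "0 \<le> i" "i \<le> 1" "z = (1 - i) *\<^sub>R pt p 0 + i *\<^sub>R pt 0 s"
    by (auto simp: in_segment)
  then show "z \<in> {z. 0 \<le> X z / p \<and> 0 \<le> Y z / s \<and> X z / p + Y z / s = 1}"
    using assms pt_affine_comb[of "1 - i" i p 0 0 s] by simp
next
  fix z assume z: "z \<in> {z. 0 \<le> X z / p \<and> 0 \<le> Y z / s \<and> X z / p + Y z / s = 1}"
  define i where "i = Y z / s"
  have "0 \<le> i" "i \<le> 1" "X z / p = 1 - i" "Y z = i * s"
    using z assms by (auto simp: i_def)
  moreover from this(3) have "X z = (1 - i) * p"
    using assms by (simp add: divide_eq_eq)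
  ultimately have "z = (1 - i) *\<^sub>R pt p 0 + i *\<^sub>R pt 0 s" "0 \<le> i" "i \<le> 1"
    using pt_affine_comb[of "1 - i" i p 0 0 s] eq_pt_iff[of z "(1 - i) * p" "i * s"] by simp_all
  then show "z \<in> closed_segment (pt p 0) (pt 0 s)"
    by (auto simp: in_segment)
qed

text \<open>The sign conditions put both segments in the same quadrant. The last one says that 1
  lies strictly between \<open>r / p\<close> and \<open>t / s\<close>, so the endpoints of the
  second segment are on opposite sides of the line of the first.\<close>

lemma segments_meet:
  assumes "p \<noteq> 0" "s \<noteq> 0" "0 < r / p" "0 < t / s" "0 < (1 - r / p) * (t / s - 1)"
  shows "closed_segment (pt p 0) (pt 0 s) \<inter> closed_segment (pt r 0) (pt 0 t) \<noteq> {}"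
proof -
  define \<rho> \<tau> where "\<rho> = r / p" and "\<tau> = t / s"
  have rt: "r = \<rho> * p" "t = \<tau> * s" "r \<noteq> 0" "t \<noteq> 0"
    using assms by (auto simp: \<rho>_def \<tau>_def)
  \<comment> \<open>The parameter at which the second segment meets the first, that is, the solution
    of \<open>(1 - i) * \<rho> + i * \<tau> = 1\<close>.\<close>
  define i where "i = (1 - \<rho>) / (\<tau> - \<rho>)"
  have sgn: "0 < \<rho>" "0 < \<tau>" "1 < \<rho> \<and> \<tau> < 1 \<or> \<rho> < 1 \<and> 1 < \<tau>"
    using assms(3-) by (auto simp: \<rho>_def[symmetric] \<tau>_def[symmetric] zero_less_mult_iff)
  have ne: "\<tau> - \<rho> \<noteq> 0" using sgn by auto
  have i: "0 \<le> i" "i \<le> 1"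
    using sgn by (auto simp: i_def divide_le_eq zero_le_divide_iff)
  have "i * (\<tau> - \<rho>) = 1 - \<rho>"
    using ne by (simp add: i_def)
  then have "(1 - i) * \<rho> + i * \<tau> = 1" by (simp add: algebra_simps)
  then have "pt ((1 - i) * r) (i * t) \<in> closed_segment (pt p 0) (pt 0 s) \<inter> closed_segment (pt r 0) (pt 0 t)"
    using assms(1,2) rt(3,4) sgn(1,2) i by (simp add: closed_segment_axes) (simp add: rt)
  then show ?thesis by blast
qed

lemma crossed_axes:
  assumes "0 < p * r" "0 < s * t" "p \<noteq> r" "s \<noteq> t"
  shows "crossed (pt p 0) (pt 0 s) (pt r 0) (pt 0 t)"
proof -
  have nz: "p \<noteq> 0" "r \<noteq> 0" "s \<noteq> 0" "t \<noteq> 0" using assms by auto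
  have pos: "0 < r / p" "0 < p / r" "0 < t / s"
    using assms(1,2) by (auto simp: zero_less_mult_iff zero_less_divide_iff)
  \<comment> \<open>The two products belong to the two pairs of opposite sides. They differ by a
    negative factor and do not vanish, so one of them is positive and that pair of sides
    meets.\<close>
  have "(1 - r / p) * (t / s - 1) = - (r / p) * ((1 - p / r) * (t / s - 1))"
    using nz by (simp add: field_simps)
  moreover have "(1 - p / r) * (t / s - 1) \<noteq> 0"
    using nz assms(3,4) by (simp add: divide_eq_1_iff)
  ultimately consider "0 < (1 - r / p) * (t / s - 1)" | "0 < (1 - p / r) * (t / s - 1)"
    using pos(1) by (metis linorder_neqE_linordered_idom mult_neg_neg neg_less_0_iff_less)
  then show ?thesis
  proof cases
    case 1
    then show ?thesis
      unfolding crossed_def using segments_meet[of p s r t] nz pos by simp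
  next
    case 2
    then show ?thesis
      unfolding crossed_def using segments_meet[of r s p t] nz pos
      by (simp add: closed_segment_commute)
  qed
qed

text \<open>The region is the unit ball of the gauge \<open>max (x/p) (x/r) + max (y/s) (y/t)\<close>.\<close>
lemma convex_region_if_diagonals_cross:
  assumes "p * r < 0" "s * t < 0"
  shows "\<exists>R. open R \<and> bounded R \<and> convex R \<and>
    frontier R = boundary (pt p 0) (pt 0 s) (pt r 0) (pt 0 t)"
proof -
  define g where "g z = max (X z / p) (X z / r) + max (Y z / s) (Y z / t)" for z
  have nz: "p \<noteq> 0" "r \<noteq> 0" "s \<noteq> 0" "t \<noteq> 0" using assms by auto
  have sgn: "x / p \<ge> 0 \<longleftrightarrow> x / r \<le> 0" "x / s \<ge> 0 \<longleftrightarrow> x / t \<le> 0" for x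
    using assms by (auto simp: zero_le_divide_iff divide_le_0_iff mult_less_0_iff)
  have max_nonneg: "0 \<le> max (x / p) (x / r)" "0 \<le> max (x / s) (x / t)" for x
    using sgn(1)[of x] sgn(2)[of x] by linarith+
  have cont: "continuous_on UNIV g"
    unfolding g_def by (intro continuous_intros continuous_X continuous_Y) (use nz in auto)
  define R where "R = {z. g z < 1}"
  have "open R"
    unfolding R_def by (intro open_Collect_less cont continuous_on_const)
  have "convex {z. X z / p' + Y z / s' < 1}" for p' s'
  proof (rule convexI)
    fix x y and a b :: real
    assume xy: "x \<in> {z. X z / p' + Y z / s' < 1}" "y \<in> {z. X z / p' + Y z / s' < 1}"
      and ab: "0 \<le> a" "0 \<le> b" "a + b = 1"
    have "a * (X x / p' + Y x / s') + b * (X y / p' + Y y / s') < 1"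
      using xy ab by (intro convex_bound_lt) auto
    then show "a *\<^sub>R x + b *\<^sub>R y \<in> {z. X z / p' + Y z / s' < 1}"
      using ab by (simp add: X_affine_comb Y_affine_comb algebra_simps add_divide_distrib)
  qed
  \<comment> \<open>A sum of two maxima is below 1 exactly if all four sums of entries are, so
    \<open>R\<close> is an intersection of four half-planes.\<close>
  moreover have "R = {z. X z / p + Y z / s < 1} \<inter> {z. X z / p + Y z / t < 1}
      \<inter> {z. X z / r + Y z / s < 1} \<inter> {z. X z / r + Y z / t < 1}"
    unfolding R_def g_def by (auto simp: max_def)
  ultimately have "convex R" by (simp add: convex_Int)
  have bd: "\<bar>x\<bar> \<le> \<bar>p\<bar> + \<bar>r\<bar>" if "p * r < 0" "max (x / p) (x / r) \<le> 1" for x p r :: real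
    using that by (auto simp: mult_less_0_iff divide_le_eq)
  have "bounded R"
  proof (rule boundedI_in_frame)
    fix z assume "z \<in> R"
    then have "max (X z / p) (X z / r) \<le> 1" "max (Y z / s) (Y z / t) \<le> 1"
      using max_nonneg[of "X z"] max_nonneg[of "Y z"] unfolding R_def g_def by auto
    from bd[OF assms(1) this(1)] bd[OF assms(2) this(2)]
    show "\<bar>X z\<bar> \<le> \<bar>p\<bar> + \<bar>r\<bar> + \<bar>s\<bar> + \<bar>t\<bar>" "\<bar>Y z\<bar> \<le> \<bar>p\<bar> + \<bar>r\<bar> + \<bar>s\<bar> + \<bar>t\<bar>"
      by linarith+
  qed
  have "closure R \<subseteq> {z. g z \<le> 1}"
    by (intro closure_minimal closed_Collect_le cont continuous_on_const) (auto simp: R_def)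
  \<comment> \<open>Points of the level set are approached from inside by shrinking towards the
    origin, since \<open>g\<close> is homogeneous for nonnegative factors.\<close>
  moreover have "z \<in> closure R" if "g z = 1" for z
    unfolding closure_sequential
  proof (intro exI conjI allI)
    let ?c = "\<lambda>n. 1 - inverse (real (Suc n))"
    show "pt (?c n * X z) (?c n * Y z) \<in> R" for n
    proof -
      have c: "0 \<le> ?c n" "?c n < 1" by (simp_all add: inverse_le_1_iff)
      have "g (pt (?c n * X z) (?c n * Y z)) = ?c n * g z"
        unfolding g_def X_pt Y_pt distrib_left max_mult_distrib_left using c by simp
      then show ?thesis using that c by (simp add: R_def)
    qed
    have "?c \<longlonglongrightarrow> 1"
      using tendsto_diff[OF tendsto_const LIMSEQ_inverse_real_of_nat, of 1] by simp
    then have "(\<lambda>n. pt (?c n * X z) (?c n * Y z)) \<longlonglongrightarrow> pt (1 * X z) (1 * Y z)"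
      unfolding pt_def by (intro tendsto_intros)
    then show "(\<lambda>n. pt (?c n * X z) (?c n * Y z)) \<longlonglongrightarrow> z" by simp
  qed
  ultimately have "frontier R = {z. g z = 1}"
    unfolding frontier_def interior_open[OF \<open>open R\<close>] by (auto simp: R_def not_less)
  also have "\<dots> = boundary (pt p 0) (pt 0 s) (pt r 0) (pt 0 t)"
  proof -
    \<comment> \<open>Within each pair the entries have opposite signs or are both zero. In each
      quadrant the maxima therefore select the intercept form of one side.\<close>
    have max: "max a a' + max b b' = 1 \<longleftrightarrow> 0 \<le> a \<and> 0 \<le> b \<and> a + b = 1 \<or> 0 \<le> a' \<and> 0 \<le> b \<and> a' + b = 1
        \<or> 0 \<le> a' \<and> 0 \<le> b' \<and> a' + b' = 1 \<or> 0 \<le> a \<and> 0 \<le> b' \<and> a + b' = 1"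
      if "0 < a \<and> a' < 0 \<or> a < 0 \<and> 0 < a' \<or> a = 0 \<and> a' = 0"
        "0 < b \<and> b' < 0 \<or> b < 0 \<and> 0 < b' \<or> b = 0 \<and> b' = 0" for a a' b b' :: real
      using that unfolding max_def by (smt (verit))
    have "0 < x / p \<and> x / r < 0 \<or> x / p < 0 \<and> 0 < x / r \<or> x / p = 0 \<and> x / r = 0"
      "0 < x / s \<and> x / t < 0 \<or> x / s < 0 \<and> 0 < x / t \<or> x / s = 0 \<and> x / t = 0" for x
      using assms by (auto simp: zero_less_divide_iff divide_less_0_iff mult_less_0_iff)
    note max_XY = max[OF this]
    have seg: "closed_segment (pt 0 s) (pt r 0) = closed_segment (pt r 0) (pt 0 s)"
      "closed_segment (pt 0 t) (pt p 0) = closed_segment (pt p 0) (pt 0 t)"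
      by (rule closed_segment_commute)+
    have "g z = 1 \<longleftrightarrow> z \<in> boundary (pt p 0) (pt 0 s) (pt r 0) (pt 0 t)" for z
      unfolding boundary_def seg closed_segment_axes[OF nz(1,3)] closed_segment_axes[OF nz(2,3)]
        closed_segment_axes[OF nz(2,4)] closed_segment_axes[OF nz(1,4)] g_def max_XY
        Un_iff mem_Collect_eq by (simp only: disj_assoc)
    then show ?thesis by blast
  qed
  finally show ?thesis
    using \<open>open R\<close> \<open>bounded R\<close> \<open>convex R\<close> by blast
qed

end

section \<open>Quadrilaterals with a vertex inside the triangle of the other three\<close>

lemma reflex_vertex_comb:
  fixes w u v :: "'a :: real_vector"
  assumes "p * r < 0" "0 < s / t" "s / t < 1"
  obtains x y z :: real where "0 < x" "0 < y" "0 < z" "x + y + z = 1"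
    "x *\<^sub>R (w + p *\<^sub>R u) + y *\<^sub>R (w + r *\<^sub>R u) + z *\<^sub>R (w + t *\<^sub>R v) = w + s *\<^sub>R v"
proof -
  have "r - p \<noteq> 0" "t \<noteq> 0" using assms by auto
  \<comment> \<open>The origin \<open>w\<close> is a convex combination, with weights
    \<open>i\<close> and \<open>1 - i\<close>, of the two points on opposite sides of it. The target
    lies between \<open>w\<close> and \<open>w + t *\<^sub>R v\<close> at ratio
    \<open>s / t\<close>; nesting the two combinations gives the weights.\<close>
  define i where "i = r / (r - p)"
  have "i * (r - p) = r" using \<open>r - p \<noteq> 0\<close> by (simp add: i_def)
  then have i0: "i * p + (1 - i) * r = 0" by (simp add: algebra_simps)
  have i: "0 < i" "i < 1"
    using assms(1) by (auto simp: i_def mult_less_0_iff zero_less_divide_iff divide_less_eq)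
  define k where "k = s / t"
  have k: "0 < k" "k < 1" "k * t = s" using assms(2,3) \<open>t \<noteq> 0\<close> by (auto simp: k_def)
  have "((1 - k) * i) *\<^sub>R (w + p *\<^sub>R u) + ((1 - k) * (1 - i)) *\<^sub>R (w + r *\<^sub>R u) + k *\<^sub>R (w + t *\<^sub>R v)
      = ((1 - k) * i + (1 - k) * (1 - i) + k) *\<^sub>R w + ((1 - k) * (i * p + (1 - i) * r)) *\<^sub>R u + (k * t) *\<^sub>R v"
    by (simp only: scaleR_add_right scaleR_add_left scaleR_scaleR distrib_left mult.assoc) (simp add: algebra_simps)
  also have "\<dots> = w + s *\<^sub>R v" unfolding i0 using k by (simp add: algebra_simps)
  finally have "((1 - k) * i) *\<^sub>R (w + p *\<^sub>R u) + ((1 - k) * (1 - i)) *\<^sub>R (w + r *\<^sub>R u)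
      + k *\<^sub>R (w + t *\<^sub>R v) = w + s *\<^sub>R v" .
  moreover have "(1 - k) * i + (1 - k) * (1 - i) + k = 1" by (simp add: algebra_simps)
  ultimately show ?thesis
    using i k by (intro that[of "(1 - k) * i" "(1 - k) * (1 - i)" k]) simp_all
qed

text \<open>Of the two vertices on the axis along \<open>v\<close>, the one nearer to
  \<open>w\<close> is inside the triangle of the other three. The vectors \<open>u\<close> and
  \<open>v\<close> are free variables here, so that the diagonals can exchange roles.\<close>

lemma no_convex_region_if_reflex:
  assumes "cross2 u v \<noteq> 0" "p * r < 0" "0 < s * t" "s \<noteq> t" "open R" "convex R"
  shows "\<not> {w + p *\<^sub>R u, w + r *\<^sub>R u, w + s *\<^sub>R v, w + t *\<^sub>R v} \<subseteq> frontier R"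
proof
  assume sub: "{w + p *\<^sub>R u, w + r *\<^sub>R u, w + s *\<^sub>R v, w + t *\<^sub>R v} \<subseteq> frontier R"
  have *: False if st: "0 < s / t" "s / t < 1" "t \<noteq> 0" and sub': "{w + s *\<^sub>R v, w + t *\<^sub>R v} \<subseteq> frontier R" for s t
  proof -
    have "cross2 (w + r *\<^sub>R u - (w + p *\<^sub>R u)) (w + t *\<^sub>R v - (w + p *\<^sub>R u)) = (r - p) * t * cross2 u v"
      by (simp add: cross2_def algebra_simps)
    then have "\<not> collinear {w + p *\<^sub>R u, w + r *\<^sub>R u, w + t *\<^sub>R v}"
      using assms(1,2) st(3) by (auto simp: collinear_iff_cross2)
    moreover obtain x y z where "0 < x" "0 < y" "0 < z" "x + y + z = 1"
      "x *\<^sub>R (w + p *\<^sub>R u) + y *\<^sub>R (w + r *\<^sub>R u) + z *\<^sub>R (w + t *\<^sub>R v) = w + s *\<^sub>R v"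
      using reflex_vertex_comb[OF assms(2) st(1,2)] by metis
    ultimately show False
      using triangle_interior_not_in_frontier[of "w + p *\<^sub>R u" "w + r *\<^sub>R u" "w + t *\<^sub>R v" R x y z]
        assms(5,6) sub sub' by simp
  qed
  have "s \<noteq> 0" "t \<noteq> 0" using assms(3) by auto
  moreover have "0 < s / t" "0 < t / s" using assms(3) by (auto simp: zero_less_mult_iff zero_less_divide_iff)
  moreover from this have "s / t < 1 \<or> t / s < 1"
    using assms(4) by (auto simp: divide_less_eq zero_less_divide_iff)
  ultimately show False using *[of s t] *[of t s] sub by auto
qed

section \<open>The conic of centers\<close>

text \<open>The vertices are \<open>pt p 0\<close>, \<open>pt 0 s\<close>, \<open>pt r 0\<close>,
  \<open>pt 0 t\<close> in order. The two inequalities in \<open>not_trapezoid\<close> say that the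
  determinants of the two pairs of opposite sides do not vanish.\<close>

locale quadrilateral_frame = affine_frame +
  fixes p r s t :: real
  assumes nonzero: "p \<noteq> 0" "r \<noteq> 0" "s \<noteq> 0" "t \<noteq> 0"
    and distinct: "p \<noteq> r" "s \<noteq> t"
    and not_trapezoid: "p * t \<noteq> r * s" "p * s \<noteq> r * t"
begin

abbreviation "vertices \<equiv> {pt p 0, pt 0 s, pt r 0, pt 0 t}"

definition center_conic :: "(real^2) set" where
  "center_conic = {z. s * t * X z * (2 * X z - (p + r)) = p * r * Y z * (2 * Y z - (s + t))}"

lemma pt_in_center_conic:
  "pt x y \<in> center_conic \<longleftrightarrow> s * t * x * (2 * x - (p + r)) = p * r * y * (2 * y - (s + t))"
  by (simp add: center_conic_def)

lemma center_conic_eq_quadr: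
  "center_conic = {z. quadr (2 * s * t) 0 (- 2 * p * r) (- s * t * (p + r)) (p * r * (s + t)) 0 (X z) (Y z) = 0}"
  unfolding center_conic_def quadr_def by (auto simp: power2_eq_square algebra_simps)

lemma nondegenerate: "s * t * (p + r)\<^sup>2 - p * r * (s + t)\<^sup>2 \<noteq> 0"
proof -
  have "s * t * (p + r)\<^sup>2 - p * r * (s + t)\<^sup>2 = (p * s - r * t) * (p * t - r * s)"
    by (simp add: power2_eq_square algebra_simps)
  then show ?thesis using not_trapezoid by simp
qed

lemma center_conic_canonical:
  "center_conic = {z. 2 * s * t * (X z - (p + r) / 4)\<^sup>2 + - 2 * p * r * (Y z - (s + t) / 4)\<^sup>2
     = (s * t * (p + r)\<^sup>2 - p * r * (s + t)\<^sup>2) / 8}"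
  unfolding center_conic_def by (auto simp: power2_eq_square field_simps)

lemma hyperbola_center_conic_iff: "hyperbola center_conic \<longleftrightarrow> 0 < (p * r) * (s * t)"
proof
  assume pos: "0 < (p * r) * (s * t)"
  have "(2 * s * t) * (- 2 * p * r) = - 4 * ((p * r) * (s * t))" by simp
  then have "(2 * s * t) * (- 2 * p * r) < 0" using pos by linarith
  then show "hyperbola center_conic"
    unfolding center_conic_canonical by (rule hyperbola_in_frame) (use nondegenerate in simp)
next
  assume hyp: "hyperbola center_conic"
  show "0 < (p * r) * (s * t)"
  proof (rule ccontr)
    assume "\<not> 0 < (p * r) * (s * t)"
    then have "(p * r) * (s * t) < 0" using nonzero by (simp add: less_le)
    moreover have "(2 * s * t) * (- 2 * p * r) = - 4 * ((p * r) * (s * t))" by simp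
    ultimately have "(2 * s * t) * (- 2 * p * r) > 0" by linarith
    then have "bounded center_conic"
      unfolding center_conic_canonical by (rule bounded_ellipse_in_frame)
    then show False using not_bounded_hyperbola hyp by blast
  qed
qed

lemma conic_section_center_conic: "conic_section center_conic"
proof -
  have "pt 0 0 \<in> center_conic" by (simp add: pt_in_center_conic)
  moreover have "(2 * s * t, 0, - 2 * p * r) \<noteq> (0, 0, 0)" using nonzero by simp
  ultimately show ?thesis
    unfolding conic_section_in_frame using center_conic_eq_quadr by blast
qed

lemma midpoints_in_center_conic:
  "midpoint (pt p 0) (pt 0 s) \<in> center_conic" "midpoint (pt 0 s) (pt r 0) \<in> center_conic"
  "midpoint (pt r 0) (pt 0 t) \<in> center_conic" "midpoint (pt 0 t) (pt p 0) \<in> center_conic"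
  "midpoint (pt p 0) (pt r 0) \<in> center_conic" "midpoint (pt 0 s) (pt 0 t) \<in> center_conic"
  unfolding midpoint_pt pt_in_center_conic by (simp_all add: algebra_simps)

lemma center_in_center_conic:
  assumes "conic_section C" "vertices \<subseteq> C" "is_center m C"
  shows "m \<in> center_conic"
proof -
  obtain a b c d e f where abc: "(a, b, c) \<noteq> (0, 0, 0)"
    and C: "C = {z. quadr a b c d e f (X z) (Y z) = 0}"
    using assms(1) unfolding conic_section_in_frame by blast
  define x y where "x = X m" and "y = Y m"
  have D: "2 * a * x + b * y + d = 0" and E: "b * x + 2 * c * y + e = 0"
    unfolding x_def y_def
    by (rule gradient_eq_0_if_is_center[OF assms(3) C, of p 0 r 0 0 s]; use assms(2) nonzero distinct in simp)+
  have "quadr a b c d e f p 0 = 0" "quadr a b c d e f r 0 = 0"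
    "quadr a b c d e f 0 s = 0" "quadr a b c d e f 0 t = 0"
    using assms(2) unfolding C by simp_all
  then have q: "a * p\<^sup>2 + d * p + f = 0" "a * r\<^sup>2 + d * r + f = 0"
    "c * s\<^sup>2 + e * s + f = 0" "c * t\<^sup>2 + e * t + f = 0"
    by (simp_all add: quadr_def)
  have "(p - r) * (a * (p + r) + d) = 0" "(s - t) * (c * (s + t) + e) = 0"
    using q by algebra+
  \<comment> \<open>Vieta's formulas on each axis: \<open>p\<close>, \<open>r\<close> and
    \<open>s\<close>, \<open>t\<close> are the zeros of the restricted polynomials. This leaves only
    the pencil of conics through the vertices.\<close>
  then have "a * (p + r) + d = 0" "c * (s + t) + e = 0"
    using distinct by simp_all
  then have d: "d = - a * (p + r)" and e: "e = - c * (s + t)"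
    by simp_all
  have f: "f = a * (p * r)" "f = c * (s * t)"
    using q unfolding d e by (simp_all add: power2_eq_square algebra_simps)
  \<comment> \<open>Subtracting \<open>y\<close> times the second gradient equation from
    \<open>x\<close> times the first eliminates \<open>b\<close>.\<close>
  have ac: "a * (x * (2 * x - (p + r))) = c * (y * (2 * y - (s + t)))"
    using D E unfolding d e by algebra
  show ?thesis
  \<comment> \<open>If \<open>f = 0\<close>, the conic is the pair of lines containing the
    diagonals, whose center is the origin. Otherwise the two expressions for \<open>f\<close> turn
    \<open>ac\<close> into the equation of \<open>center_conic\<close>.\<close>
  proof (cases "f = 0")
    case True
    then have "a = 0" "c = 0" using f nonzero by auto
    with abc have "b \<noteq> 0" by simp
    then have "x = 0" "y = 0"
      using D E \<open>a = 0\<close> \<open>c = 0\<close> unfolding d e by simp_all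
    then show ?thesis by (simp add: center_conic_def x_def y_def)
  next
    case False
    have "f * (s * t * x * (2 * x - (p + r))) = (s * t) * (p * r) * (a * (x * (2 * x - (p + r))))"
      by (simp add: f(1))
    also have "\<dots> = f * (p * r * y * (2 * y - (s + t)))"
      unfolding ac by (simp add: f(2))
    finally show ?thesis
      using False by (simp add: center_conic_def x_def y_def)
  qed
qed

lemma unique_center_if_in_center_conic:
  assumes "m \<in> center_conic"
  shows "\<exists>C. conic_section C \<and> vertices \<subseteq> C \<and> is_unique_center m C"
proof -
  define x y where "x = X m" and "y = Y m"
  have m: "s * t * x * (2 * x - (p + r)) = p * r * y * (2 * y - (s + t))"
    using assms by (simp add: center_conic_def x_def y_def)
  text \<open>\<open>(l, k)\<close> spans the conics of the pencil whose gradient vanishes at \<open>m\<close>.\<close>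
  obtain l k where lk: "l \<noteq> 0 \<or> k \<noteq> 0"
    and D: "s * t * l * (2 * x - (p + r)) + k * y = 0"
    and E: "k * x + p * r * l * (2 * y - (s + t)) = 0"
  proof -
    \<comment> \<open>If a coordinate of \<open>m\<close> is nonzero, it is taken as
      \<open>l\<close>; one gradient equation then fixes \<open>k\<close> and the other follows from
      \<open>m\<close>. At the origin the pair of diagonals, \<open>l = 0\<close> and
      \<open>k = 1\<close>, is taken.\<close>
    consider "y \<noteq> 0" | "y = 0" "x \<noteq> 0" | "y = 0" "x = 0" by blast
    then show ?thesis
    proof cases
      case 1
      then show ?thesis
        using m by (intro that[of y "- s * t * (2 * x - (p + r))"]) (simp_all add: algebra_simps)
    next
      case 2
      then show ?thesis
        using m by (intro that[of x "- p * r * (2 * y - (s + t))"]) (simp_all add: algebra_simps)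
    next
      case 3
      then show ?thesis by (intro that[of 0 1]) simp_all
    qed
  qed
  define C where "C = {z. quadr (s * t * l) k (p * r * l) (- s * t * l * (p + r)) (- p * r * l * (s + t))
    (p * r * s * t * l) (X z) (Y z) = 0}"
  have vertices: "vertices \<subseteq> C"
    unfolding C_def quadr_def by (simp add: power2_eq_square algebra_simps)
  moreover have "(s * t * l, k, p * r * l) \<noteq> (0, 0, 0)" using lk nonzero by auto
  ultimately have "conic_section C"
    unfolding conic_section_in_frame C_def by blast
  have "is_center m C"
    unfolding C_def using D E unfolding x_def y_def
    by (intro is_center_if_gradient_eq_0) (simp_all add: algebra_simps)
  moreover have "m' = m" if "is_center m' C" for m'
  proof -
    define x' y' where "x' = X m'" and "y' = Y m'"
    have "2 * (s * t * l) * x' + k * y' + (- s * t * l * (p + r)) = 0"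
      "k * x' + 2 * (p * r * l) * y' + (- p * r * l * (s + t)) = 0"
      unfolding x'_def y'_def
      by (rule gradient_eq_0_if_is_center[OF that C_def, of p 0 r 0 0 s]; use vertices nonzero distinct in simp)+
    then have "2 * (s * t * l) * (x' - x) + k * (y' - y) = 0" "k * (x' - x) + 2 * (p * r * l) * (y' - y) = 0"
      using D E by (simp_all add: algebra_simps)
    then have *: "(4 * (p * r * s * t) * l\<^sup>2 - k\<^sup>2) * (x' - x) = 0" "(4 * (p * r * s * t) * l\<^sup>2 - k\<^sup>2) * (y' - y) = 0"
      by algebra+
    \<comment> \<open>This is the determinant of the linear system for a second center. If it
      vanished, solvability of the gradient equations at \<open>m\<close> would force a relation
      between \<open>l\<close> and \<open>k\<close> whose square contradicts
      \<open>nondegenerate\<close>.\<close>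
    have "4 * (p * r * s * t) * l\<^sup>2 - k\<^sup>2 \<noteq> 0"
    proof
      assume k2: "4 * (p * r * s * t) * l\<^sup>2 - k\<^sup>2 = 0"
      then have "l \<noteq> 0" using lk by auto
      have "p * r * l * (2 * s * t * l * (p + r) - (s + t) * k) = 0"
        using D E k2 by algebra
      then have "2 * s * t * l * (p + r) = (s + t) * k"
        using nonzero \<open>l \<noteq> 0\<close> by simp
      then have "4 * (s * t) * l\<^sup>2 * (s * t * (p + r)\<^sup>2 - p * r * (s + t)\<^sup>2) = 0"
        using k2 by algebra
      then show False using nondegenerate nonzero \<open>l \<noteq> 0\<close> by simp
    qed
    with * have "x' = x" "y' = y" by simp_all
    then show "m' = m" by (metis pt_X_Y x_def y_def x'_def y'_def)
  qed
  ultimately show ?thesis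
    using vertices \<open>conic_section C\<close> unfolding is_unique_center_def by blast
qed

lemma unique_center_center_conic:
  "is_unique_center (pt ((p + r) / 4) ((s + t) / 4)) center_conic"
  unfolding is_unique_center_def
proof (intro conjI allI impI)
  show "is_center (pt ((p + r) / 4) ((s + t) / 4)) center_conic"
    unfolding center_conic_eq_quadr
    by (rule is_center_if_gradient_eq_0) (simp_all add: field_simps)
next
  fix m assume m: "is_center m center_conic"
  have "2 * (2 * s * t) * X m + 0 * Y m + (- s * t * (p + r)) = 0"
    "0 * X m + 2 * (- 2 * p * r) * Y m + (p * r * (s + t)) = 0"
    \<comment> \<open>Midpoints of three sides serve as the non-collinear points; the two
      differences from the first are halves of the diagonals. The unsimplified arguments match the
      form given by \<open>midpoint_pt\<close>.\<close>
    by (rule gradient_eq_0_if_is_center[OF m center_conic_eq_quadr,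
          of "(p + 0) / 2" "(0 + s) / 2" "(0 + r) / 2" "(s + 0) / 2" "(0 + p) / 2" "(t + 0) / 2"];
        use midpoints_in_center_conic[unfolded midpoint_pt] nonzero distinct in simp)+
  then have "(s * t) * (4 * X m - (p + r)) = 0" "(p * r) * (4 * Y m - (s + t)) = 0"
    by (simp_all add: algebra_simps)
  then show "m = pt ((p + r) / 4) ((s + t) / 4)"
    using nonzero by (simp add: eq_pt_iff)
qed

lemma in_line_axes:
  assumes "z \<in> line (pt p' 0) (pt 0 s')"
  shows "s' * X z + p' * Y z = p' * s'"
proof -
  obtain a b where "a + b = 1" "z = a *\<^sub>R pt p' 0 + b *\<^sub>R pt 0 s'"
    using assms by (auto simp: affine_hull_2)
  then have "X z = a * p'" "Y z = b * s'" by (simp_all add: X_affine_comb Y_affine_comb)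
  then have "s' * X z + p' * Y z = (a + b) * (p' * s')" by (simp add: algebra_simps)
  then show ?thesis using \<open>a + b = 1\<close> by simp
qed

text \<open>Geometrically, two opposite extended sides form a degenerate conic through the vertices,
  centered at their intersection. The proof derives the equation of \<open>center_conic\<close>
  directly from the equations of the two lines.\<close>

lemma hidden_vertices_in_center_conic:
  "hidden_vertices (pt p 0) (pt 0 s) (pt r 0) (pt 0 t) \<subseteq> center_conic"
proof -
  have "cross2 (pt 0 s - pt p 0) (pt 0 t - pt r 0) \<noteq> 0" "cross2 (pt r 0 - pt 0 s) (pt p 0 - pt 0 t) \<noteq> 0"
    unfolding cross2_pt_diff using independent not_trapezoid by (auto simp: mult.commute)
  note in_lines = intersection_point_in_lines[OF this(1)] intersection_point_in_lines[OF this(2)]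
  have "z \<in> center_conic" if "z \<in> hidden_vertices (pt p 0) (pt 0 s) (pt r 0) (pt 0 t)" for z
  proof -
    from that consider "z \<in> line (pt p 0) (pt 0 s)" "z \<in> line (pt r 0) (pt 0 t)"
      | "z \<in> line (pt 0 s) (pt r 0)" "z \<in> line (pt 0 t) (pt p 0)"
      unfolding hidden_vertices_def
      using in_lines by blast
    then show ?thesis
    proof cases
      case 1
      then have "s * X z + p * Y z = p * s" "t * X z + r * Y z = r * t"
        by (auto dest: in_line_axes)
      then show ?thesis unfolding center_conic_def mem_Collect_eq by algebra
    next
      case 2
      then have "z \<in> line (pt r 0) (pt 0 s)" "z \<in> line (pt p 0) (pt 0 t)"
        by (simp_all only: insert_commute)
      then have "s * X z + r * Y z = r * s" "t * X z + p * Y z = p * t"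
        by (auto dest: in_line_axes)
      then show ?thesis unfolding center_conic_def mem_Collect_eq by algebra
    qed
  qed
  then show ?thesis by blast
qed

section \<open>Strict convexity and the sign of the product of the four vertex coordinates\<close>

lemma diagonals_cross_if_convex_region:
  assumes R: "open R" "convex R" "frontier R = boundary (pt p 0) (pt 0 s) (pt r 0) (pt 0 t)"
  shows "0 < (p * r) * (s * t)"
proof (rule ccontr)
  assume "\<not> 0 < (p * r) * (s * t)"
  moreover have "p * r \<noteq> 0" "s * t \<noteq> 0" using nonzero by simp_all
  ultimately have neg: "p * r < 0 \<and> 0 < s * t \<or> s * t < 0 \<and> 0 < p * r"
    unfolding zero_less_mult_iff[of "p * r" "s * t"] by argo
  have sub: "{w + p *\<^sub>R u, w + r *\<^sub>R u, w + s *\<^sub>R v, w + t *\<^sub>R v} \<subseteq> frontier R"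
    unfolding R(3) boundary_def by (simp add: pt_def)
  have "cross2 v u \<noteq> 0" using independent by (simp add: cross2_def mult.commute)
  from neg show False
  proof
    assume "p * r < 0 \<and> 0 < s * t"
    then show False
      using no_convex_region_if_reflex[OF independent, of p r s t R w] distinct R sub by simp
  next
    assume "s * t < 0 \<and> 0 < p * r"
    then show False
      using no_convex_region_if_reflex[OF \<open>cross2 v u \<noteq> 0\<close>, of s t p r R w] distinct R sub by simp
  qed
qed

lemma convex_region_iff:
  assumes "\<not> crossed (pt p 0) (pt 0 s) (pt r 0) (pt 0 t)"
  shows "(\<exists>R. open R \<and> bounded R \<and> convex R \<and> frontier R = boundary (pt p 0) (pt 0 s) (pt r 0) (pt 0 t))
    \<longleftrightarrow> 0 < (p * r) * (s * t)"
proof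
  assume "0 < (p * r) * (s * t)"
  moreover have "\<not> (0 < p * r \<and> 0 < s * t)"
    using crossed_axes assms distinct by blast
  ultimately have "p * r < 0" "s * t < 0" by (auto simp: zero_less_mult_iff)
  then show "\<exists>R. open R \<and> bounded R \<and> convex R \<and> frontier R = boundary (pt p 0) (pt 0 s) (pt r 0) (pt 0 t)"
    by (rule convex_region_if_diagonals_cross)
qed (use diagonals_cross_if_convex_region in blast)

end

section \<open>Choice of the frame and transfer to the given vertices\<close>

theorem theorem4p4:
  fixes q1 q2 q3 q4 :: "real^2"
  assumes "\<not> trapezoid q1 q2 q3 q4"
    and "\<not> affine_parallel (line q1 q3) (line q2 q4)"
    and "no_three_collinear q1 q2 q3 q4"
  shows "\<exists>H. conic_section H \<and>
    (\<forall>c C. conic_section C \<and> {q1, q2, q3, q4} \<subseteq> C \<and> is_center c C \<longrightarrow> c \<in> H) \<and>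
    (\<forall>c\<in>H. \<exists>C. conic_section C \<and> {q1, q2, q3, q4} \<subseteq> C \<and> is_unique_center c C) \<and>
    {midpoint q1 q2, midpoint q2 q3, midpoint q3 q4, midpoint q4 q1} \<subseteq> H \<and>
    {midpoint q1 q3, midpoint q2 q4} \<subseteq> H \<and>
    hidden_vertices q1 q2 q3 q4 \<subseteq> H \<and>
    intersection_point (line q1 q3) (line q2 q4) \<in> H \<and>
    is_unique_center ((1 / 4) *\<^sub>R (q1 + q2 + q3 + q4)) H \<and>
    (\<not> crossed q1 q2 q3 q4 \<longrightarrow> (hyperbola H \<longleftrightarrow> strictly_convex q1 q2 q3 q4))"
proof -
  have neq: "q1 \<noteq> q2" "q2 \<noteq> q3" "q3 \<noteq> q4" "q4 \<noteq> q1" "q1 \<noteq> q3" "q2 \<noteq> q4"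
    using assms(3) unfolding no_three_collinear_def by (auto simp: insert_commute)
  have indep: "cross2 (q3 - q1) (q4 - q2) \<noteq> 0"
    using assms(2) cross2_eq_0_imp_affine_parallel neq by blast
  define w where "w = intersection_point (line q1 q3) (line q2 q4)"
  have w: "w \<in> line q1 q3" "w \<in> line q2 q4"
    using intersection_point_in_lines[OF indep] by (auto simp: w_def)
  obtain i where i: "w = q1 + i *\<^sub>R (q3 - q1)" using w(1) unfolding affine_hull_2_alt by blast
  obtain j where j: "w = q2 + j *\<^sub>R (q4 - q2)" using w(2) unfolding affine_hull_2_alt by blast
  \<comment> \<open>Signed positions of \<open>q1\<close> and \<open>q3\<close> on their diagonal,
    measured from \<open>w\<close> in units of \<open>q3 - q1\<close>; likewise \<open>s\<close> and
    \<open>t\<close> for \<open>q2\<close> and \<open>q4\<close>.\<close>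
  define p r where "p = - i" and "r = 1 - i"
  define s t where "s = - j" and "t = 1 - j"
  interpret affine_frame w "q3 - q1" "q4 - q2"
    by unfold_locales (rule indep)
  have q13: "q1 = pt p 0" "q3 = pt r 0"
    unfolding pt_def p_def r_def by (simp_all add: i algebra_simps)
  have q24: "q2 = pt 0 s" "q4 = pt 0 t"
    unfolding pt_def s_def t_def by (simp_all add: j algebra_simps)
  note q = q13 q24
  have "\<not> collinear {pt p 0, pt 0 s, pt r 0}" "\<not> collinear {pt p 0, pt 0 s, pt 0 t}"
    "\<not> collinear {pt p 0, pt r 0, pt 0 t}" "\<not> collinear {pt 0 s, pt r 0, pt 0 t}"
    using assms(3) unfolding no_three_collinear_def q[symmetric] by simp_all
  then have nz: "p \<noteq> 0" "r \<noteq> 0" "s \<noteq> 0" "t \<noteq> 0" "p \<noteq> r" "s \<noteq> t"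
    unfolding collinear_iff_cross2 cross2_pt_diff by auto
  have "cross2 (q2 - q1) (q4 - q3) \<noteq> 0" "cross2 (q3 - q2) (q1 - q4) \<noteq> 0"
    using assms(1) cross2_eq_0_imp_affine_parallel neq unfolding trapezoid_def by blast+
  then have "cross2 (pt 0 s - pt p 0) (pt 0 t - pt r 0) \<noteq> 0" "cross2 (pt r 0 - pt 0 s) (pt p 0 - pt 0 t) \<noteq> 0"
    unfolding q[symmetric] .
  then have nt: "p * t \<noteq> r * s" "p * s \<noteq> r * t"
    unfolding cross2_pt_diff by (auto simp: mult.commute)
  interpret quadrilateral_frame w "q3 - q1" "q4 - q2" p r s t
    by unfold_locales (use nz nt in auto)
  have mean: "(1 / 4) *\<^sub>R (q1 + q2 + q3 + q4) = pt ((p + r) / 4) ((s + t) / 4)"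
  proof -
    have "(1 / 4) *\<^sub>R (pt p 0 + pt 0 s + pt r 0 + pt 0 t) = pt ((p + r) / 4) ((s + t) / 4)"
      by (simp add: pt_def vec_eq_iff field_simps)
    then show ?thesis unfolding q[symmetric] .
  qed
  have w_pt: "pt 0 0 = w" by (simp add: pt_def)
  have "pt 0 0 \<in> center_conic" unfolding pt_in_center_conic by simp
  then have "w \<in> center_conic" unfolding w_pt .
  note folded = center_in_center_conic[folded q] unique_center_if_in_center_conic[folded q]
    midpoints_in_center_conic[folded q] hidden_vertices_in_center_conic[folded q]
  show ?thesis
  proof (rule exI[of _ center_conic], intro conjI allI ballI impI)
    show "m \<in> center_conic" if "conic_section C \<and> {q1, q2, q3, q4} \<subseteq> C \<and> is_center m C" for m C
      using that by (intro folded(1)[of C]) simp_all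
    show "\<exists>C. conic_section C \<and> {q1, q2, q3, q4} \<subseteq> C \<and> is_unique_center m C" if "m \<in> center_conic" for m
      by (rule folded(2)[OF that])
    show "hidden_vertices q1 q2 q3 q4 \<subseteq> center_conic"
      by (rule folded)
    show "hyperbola center_conic \<longleftrightarrow> strictly_convex q1 q2 q3 q4" if "\<not> crossed q1 q2 q3 q4"
      unfolding strictly_convex_def convex_region_iff[folded q, OF that] hyperbola_center_conic_iff
      by (simp only: assms(3) simp_thms)
    show "is_unique_center ((1 / 4) *\<^sub>R (q1 + q2 + q3 + q4)) center_conic"
      unfolding mean by (rule unique_center_center_conic)
    show "intersection_point (line q1 q3) (line q2 q4) \<in> center_conic"
      using \<open>w \<in> center_conic\<close> by (simp only: w_def)
  qed (simp_all only: folded conic_section_center_conic insert_subset empty_subsetI simp_thms)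
qed

end
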